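(* Let $n\ge 2$ and let $f:\mathbb{R}_+\to\mathbb{R}$ be smooth on $(0,\infty)$ and satisfy $f(x)=O(x^2)$ as $x\to 0$, $f'(x)=O(x)$ as $x\to 0$, $f(x)=O(x^2)$ as $x\to\infty$, and, on $(0,\infty)$, $f''>0$ and $\frac{d^2}{dx^2}\left(\frac{f}{f'}\right)>0$. Let $M=(0,\infty)^n$, let $\eta(x)=\int_1^x\frac{dr}{\sqrt{f(r)}}$ for $x>0$ (a bijection $(0,\infty)\to\mathbb{R}$), let $\xi=\eta^{-1}$, and let $\Phi:M\to L^{n+1}$, $\Phi(x_1,\ldots,x_n)=(\eta(x_1),\ldots,\eta(x_n),\eta(x_1+\cdots+x_n))$. Then $S=\Phi(M)$ is a codimension $1$ submanifold of $L^{n+1}$ given by the graph of $$y_{n+1}=\eta(\xi(y_1)+\cdots+\xi(y_n)),\qquad y_1,\ldots,y_n\in\mathbb{R}.$$ On this submanifold the metric induced by $L^{n+1}$ is positive-definite and thus Riemannian. For $y\in S$, a basis of $T_yS$ is given by $$e_i=\frac{\partial}{\partial y_i}+\sqrt{\frac{f(\xi(y_i))}{f(\xi(y_{n+1}))}}\,\frac{\partial}{\partial y_{n+1}},\qquad i=1,\ldots,n.$$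
   Context: $L^{n+1}$ is $\mathbb{R}^{n+1}$ with coordinates $(y_1,\ldots,y_{n+1})$ and the flat Minkowski metric $ds_L^2=dy_1^2+\cdots+dy_n^2-dy_{n+1}^2$. The assumptions on $f$ imply $f>0$ and $f'>0$ on $(0,\infty)$. *)

theory Defs
  imports "HOL-Analysis.Analysis" "HOL-Library.Landau_Symbols"
begin

text \<open>Smoothness on an open set. The derivatives are two-sided, so the set is meant to be open.\<close>

primrec Ck_on :: "nat \<Rightarrow> 'a::euclidean_space set \<Rightarrow> ('a \<Rightarrow> 'b::euclidean_space) \<Rightarrow> bool" where
  "Ck_on 0 U h \<longleftrightarrow> continuous_on U h"
| "Ck_on (Suc k) U h \<longleftrightarrow> (\<forall>x\<in>U. h differentiable (at x)) \<and>
     (\<forall>v. Ck_on k U (\<lambda>x. frechet_derivative h (at x) v))"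

definition smooth_on :: "'a::euclidean_space set \<Rightarrow> ('a \<Rightarrow> 'b::euclidean_space) \<Rightarrow> bool" where
  "smooth_on U h \<longleftrightarrow> (\<forall>k. Ck_on k U h)"

text \<open>Smoothness on an arbitrary subset of a Euclidean space: local existence of smooth
  extensions to open sets.\<close>

definition smooth_on_subset :: "'a::euclidean_space set \<Rightarrow> ('a \<Rightarrow> 'b::euclidean_space) \<Rightarrow> bool" where
  "smooth_on_subset A h \<longleftrightarrow>
     (\<forall>p\<in>A. \<exists>V H. open V \<and> p \<in> V \<and> smooth_on V H \<and> (\<forall>q\<in>A \<inter> V. H q = h q))"

definition smooth_diffeo ::
  "'a::euclidean_space set \<Rightarrow> 'b::euclidean_space set \<Rightarrow> ('a \<Rightarrow> 'b) \<Rightarrow> bool" where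
  "smooth_diffeo U V \<phi> \<longleftrightarrow> open U \<and> open V \<and> bij_betw \<phi> U V \<and>
     smooth_on U \<phi> \<and> smooth_on V (inv_into U \<phi>)"

text \<open>Embedded smooth submanifolds of codimension \<open>k\<close>, described by slice charts.\<close>

definition smooth_submanifold :: "nat \<Rightarrow> 'a::euclidean_space set \<Rightarrow> bool" where
  "smooth_submanifold k S \<longleftrightarrow>
     (\<forall>p\<in>S. \<exists>U V (\<phi> :: 'a \<Rightarrow> 'a) L. p \<in> U \<and> smooth_diffeo U V \<phi> \<and>
        subspace L \<and> dim L + k = DIM('a) \<and> \<phi> ` (S \<inter> U) = L \<inter> V)"

text \<open>Tangent vectors are velocities of smooth curves in \<open>S\<close>, regarded as vectors of the ambient space.\<close>

definition tangent_space :: "'a::euclidean_space set \<Rightarrow> 'a \<Rightarrow> 'a set" where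
  "tangent_space S p = {v. \<exists>\<epsilon> \<gamma>. 0 < \<epsilon> \<and> smooth_on {-\<epsilon><..<\<epsilon>} \<gamma> \<and> \<gamma> ` {-\<epsilon><..<\<epsilon>} \<subseteq> S \<and>
     \<gamma> 0 = p \<and> (\<gamma> has_vector_derivative v) (at (0::real))}"

text \<open>A Riemannian metric assigns an inner product to each tangent space; it is smooth if it
  takes smooth local vector fields tangent to \<open>S\<close> to smooth functions.\<close>

definition riemannian_metric ::
  "'a::euclidean_space set \<Rightarrow> ('a \<Rightarrow> 'a \<Rightarrow> 'a \<Rightarrow> real) \<Rightarrow> bool" where
  "riemannian_metric S g \<longleftrightarrow>
     (\<forall>p\<in>S. \<forall>u\<in>tangent_space S p. \<forall>v\<in>tangent_space S p. \<forall>w\<in>tangent_space S p. \<forall>a b.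
        g p (a *\<^sub>R u + b *\<^sub>R v) w = a * g p u w + b * g p v w) \<and>
     (\<forall>p\<in>S. \<forall>v\<in>tangent_space S p. \<forall>w\<in>tangent_space S p. g p v w = g p w v) \<and>
     (\<forall>p\<in>S. \<forall>v\<in>tangent_space S p. v \<noteq> 0 \<longrightarrow> g p v v > 0) \<and>
     (\<forall>U X Y. open U \<longrightarrow> smooth_on_subset (S \<inter> U) X \<longrightarrow> smooth_on_subset (S \<inter> U) Y \<longrightarrow>
        (\<forall>p\<in>S \<inter> U. X p \<in> tangent_space S p \<and> Y p \<in> tangent_space S p) \<longrightarrow>
        smooth_on_subset (S \<inter> U) (\<lambda>p. g p (X p) (Y p)))"

text \<open>In \<open>L\<^sup>n\<^sup>+\<^sup>1\<close> the first component holds \<open>y\<^sub>1, \<dots>, y\<^sub>n\<close> and the second one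
  is the timelike coordinate.\<close>

type_synonym 'n minkowski_space = "(real ^ 'n) \<times> real"

definition minkowski :: "'n::finite minkowski_space \<Rightarrow> 'n minkowski_space \<Rightarrow> real" where
  "minkowski v w = (\<Sum>i\<in>UNIV. fst v $ i * fst w $ i) - snd v * snd w"

definition induced_metric :: "'n::finite minkowski_space set \<Rightarrow>
    'n minkowski_space \<Rightarrow> 'n minkowski_space \<Rightarrow> 'n minkowski_space \<Rightarrow> real" where
  "induced_metric S p = (\<lambda>v\<in>tangent_space S p. \<lambda>w\<in>tangent_space S p. minkowski v w)"

definition eta :: "(real \<Rightarrow> real) \<Rightarrow> real \<Rightarrow> real" where
  "eta f x = (LBINT r=ereal 1..ereal x. 1 / sqrt (f r))"

definition xi :: "(real \<Rightarrow> real) \<Rightarrow> real \<Rightarrow> real" where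
  "xi f = inv_into {0<..} (eta f)"

definition pos_orthant :: "(real ^ 'n) set" where
  "pos_orthant = {x. \<forall>i. 0 < x $ i}"

definition Phi :: "(real \<Rightarrow> real) \<Rightarrow> real ^ 'n::finite \<Rightarrow> 'n minkowski_space" where
  "Phi f x = (\<chi> i. eta f (x $ i), eta f (\<Sum>i\<in>UNIV. x $ i))"

definition frame :: "(real \<Rightarrow> real) \<Rightarrow> 'n::finite minkowski_space \<Rightarrow> 'n \<Rightarrow> 'n minkowski_space" where
  "frame f y i = (axis i 1, sqrt (f (xi f (fst y $ i)) / f (xi f (snd y))))"

end

theory Submission
  imports Defs
begin

text \<open>
  Three facts carry the result: \<open>\<eta>\<close> is a diffeomorphism from the positive half-line onto the real
  line, \<open>S\<close> is the graph of a smooth function, and this graph is spacelike because \<open>f\<close> is strictly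
  superadditive.

  Convexity together with \<open>f' = O(x)\<close> and \<open>f = O(x\<^sup>2)\<close> at the origin gives \<open>f' > 0\<close> and \<open>f > 0\<close>, so
  \<open>\<eta>' = 1 / sqrt f\<close> is positive and \<open>\<eta>\<close> is strictly increasing. The quadratic bounds on \<open>f\<close> at both
  ends of the half-line make \<open>\<eta>\<close> diverge there at least logarithmically (\<open>eta_ge_ln\<close>), so it is onto.
  The inverse satisfies \<open>\<xi>' = sqrt (f \<xi>)\<close> and is smooth by bootstrapping (\<open>smooth_xi\<close>).

  Substituting \<open>x\<^sub>i = \<xi> y\<^sub>i\<close> shows that \<open>S\<close> is the graph of \<open>G y = \<eta> (\<Sum>i. \<xi> y\<^sub>i)\<close>. Every graph of a smooth
  map is flattened by a global shear (\<open>graph_smooth_submanifold\<close>), and its tangent spaces are the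
  graphs of the derivatives of \<open>G\<close> (\<open>graph_tangent_space\<close>). With \<open>X = \<Sum>i. \<xi> y\<^sub>i\<close>, the chain rule gives the
  partial derivatives \<open>sqrt (f (\<xi> y\<^sub>i) / f X)\<close>; hence the frame \<open>e\<^sub>i\<close> is the image of the standard basis under
  \<open>v \<mapsto> (v, DG v)\<close> and is a basis of the tangent space.

  By Cauchy-Schwarz such a hyperplane is spacelike when the squares of its slopes add up to less than
  one (\<open>minkowski_pos_of_slope\<close>). Here this sum is \<open>(\<Sum>i. f x\<^sub>i) / f (\<Sum>i. x\<^sub>i)\<close>. A strictly convex function that
  vanishes at the origin has \<open>f x / x\<close> strictly increasing, so with at least two positive terms the
  quotient is smaller than one (\<open>f_superadditive\<close>).
\<close>

section \<open>Calculus of smooth maps\<close>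

lemma Ck_on_Suc_has_derivative:
  "Ck_on (Suc k) U h \<Longrightarrow> x \<in> U \<Longrightarrow> (h has_derivative frechet_derivative h (at x)) (at x)"
  by (simp add: frechet_derivative_works[symmetric])

lemma Ck_on_Suc_frechet: "Ck_on (Suc k) U h \<Longrightarrow> Ck_on k U (\<lambda>x. frechet_derivative h (at x) v)"
  by simp

text \<open>A Frechet derivative depends only on the germ of the map. As \<open>U\<close> is open, agreement on \<open>U\<close>
  therefore passes to all derivatives, whatever the maps do elsewhere.\<close>

lemma Ck_on_cong:
  assumes "open U" "\<And>x. x \<in> U \<Longrightarrow> g x = h x" "Ck_on k U h"
  shows "Ck_on k U g"
  using assms(2,3)
proof (induction k arbitrary: g h)
  case 0
  then show ?case by (auto cong: continuous_on_cong)
next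
  case (Suc k)
  have g: "(g has_derivative frechet_derivative h (at x)) (at x)" if "x \<in> U" for x
    by (rule has_derivative_transform_within_open[OF Ck_on_Suc_has_derivative[OF Suc.prems(2) that] assms(1) that])
      (simp add: Suc.prems(1))
  have "Ck_on k U (\<lambda>x. frechet_derivative g (at x) v)" for v
  proof (rule Suc.IH)
    show "frechet_derivative g (at x) v = frechet_derivative h (at x) v" if "x \<in> U" for x
      using frechet_derivative_at[OF g[OF that]] by (rule fun_cong[OF sym])
  qed (rule Ck_on_Suc_frechet[OF Suc.prems(2)])
  moreover have "g differentiable (at x)" if "x \<in> U" for x
    using g[OF that] by (rule differentiableI)
  ultimately show ?case by simp
qed

text \<open>The predicate \<open>Ck_on\<close> speaks of a derivative picked by a choice operator; this rule lets a
  derivative computed in closed form take its place.\<close>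

lemma Ck_on_has_derivI:
  assumes "open U" and D: "\<And>x. x \<in> U \<Longrightarrow> (h has_derivative D x) (at x)"
    and "\<And>v. Ck_on k U (\<lambda>x. D x v)"
  shows "Ck_on (Suc k) U h"
proof -
  have "Ck_on k U (\<lambda>x. frechet_derivative h (at x) v)" for v
    by (rule Ck_on_cong[OF assms(1) _ assms(3)[of v]]) (simp add: frechet_derivative_at[OF D, symmetric])
  moreover have "h differentiable (at x)" if "x \<in> U" for x
    using D[OF that] by (rule differentiableI)
  ultimately show ?thesis by simp
qed

lemma Ck_on_SucD: "Ck_on (Suc k) U h \<Longrightarrow> Ck_on k U h"
proof (induction k arbitrary: h)
  case 0
  then show ?case
    by (auto intro!: continuous_at_imp_continuous_on differentiable_imp_continuous_within)
next
  case (Suc k)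
  then have "Ck_on (Suc k) U (\<lambda>x. frechet_derivative h (at x) v)" for v
    by (metis Ck_on.simps(2))
  with Suc show ?case
    by (metis Ck_on.simps(2))
qed

lemma Ck_on_subset: "Ck_on k U h \<Longrightarrow> V \<subseteq> U \<Longrightarrow> Ck_on k V h"
  by (induction k arbitrary: h) (auto intro: continuous_on_subset)

lemma Ck_on_const: "open U \<Longrightarrow> Ck_on k U (\<lambda>x. c)"
  by (induction k arbitrary: c) (auto intro!: continuous_intros)

lemma Ck_on_bounded_linear:
  assumes "open U" "bounded_linear L"
  shows "Ck_on k U L"
proof (cases k)
  case 0
  then show ?thesis using assms(2) by (simp add: linear_continuous_on)
next
  case (Suc j)
  have "Ck_on (Suc j) U L"
    using assms by (intro Ck_on_has_derivI[where D = "\<lambda>_. L"] bounded_linear_imp_has_derivative Ck_on_const)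
  then show ?thesis using Suc by simp
qed

lemma Ck_on_compose_bounded_linear:
  assumes "open U" "bounded_linear L" "Ck_on k U h"
  shows "Ck_on k U (\<lambda>x. L (h x))"
  using assms(3)
proof (induction k arbitrary: h)
  case 0
  then show ?case
    using assms(2) by (auto intro: bounded_linear.continuous_on)
next
  case (Suc k)
  show ?case
  proof (rule Ck_on_has_derivI[OF assms(1)])
    show "((\<lambda>x. L (h x)) has_derivative (\<lambda>v. L (frechet_derivative h (at x) v))) (at x)"
      if "x \<in> U" for x
      using bounded_linear.has_derivative[OF assms(2) Ck_on_Suc_has_derivative[OF Suc.prems that]] .
    show "Ck_on k U (\<lambda>x. L (frechet_derivative h (at x) v))" for v
      by (rule Suc.IH[OF Ck_on_Suc_frechet[OF Suc.prems]])
  qed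
qed

lemma Ck_on_Pair:
  assumes "open U" "Ck_on k U g" "Ck_on k U h"
  shows "Ck_on k U (\<lambda>x. (g x, h x))"
  using assms(2,3)
proof (induction k arbitrary: g h)
  case 0
  then show ?case by (auto intro: continuous_on_Pair)
next
  case (Suc k)
  show ?case
  proof (rule Ck_on_has_derivI[OF assms(1)])
    show "((\<lambda>x. (g x, h x)) has_derivative
        (\<lambda>v. (frechet_derivative g (at x) v, frechet_derivative h (at x) v))) (at x)"
      if "x \<in> U" for x
      using Suc.prems that by (intro has_derivative_Pair Ck_on_Suc_has_derivative)
    show "Ck_on k U (\<lambda>x. (frechet_derivative g (at x) v, frechet_derivative h (at x) v))" for v
      by (rule Suc.IH[OF Suc.prems[THEN Ck_on_Suc_frechet]])
  qed
qed

lemma Ck_on_add: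
  assumes "open U" "Ck_on k U g" "Ck_on k U h"
  shows "Ck_on k U (\<lambda>x. g x + h x)"
  using Ck_on_compose_bounded_linear[OF assms(1) bounded_linear_add[OF bounded_linear_fst bounded_linear_snd]
      Ck_on_Pair[OF assms]] by simp

lemma Ck_on_sum:
  assumes "open U" "\<And>i. i \<in> I \<Longrightarrow> Ck_on k U (g i)"
  shows "Ck_on k U (\<lambda>x. \<Sum>i\<in>I. g i x)"
  using assms(2) by (induction I rule: infinite_finite_induct) (auto intro: Ck_on_const Ck_on_add assms(1))

text \<open>By the Leibniz rule the derivative is a sum of two products of the same kind, each pairing a map
  with a derivative; both factors are of class \<open>C\<^sup>k\<close>, so the induction hypothesis applies.\<close>

lemma Ck_on_bilinear:
  assumes "open U" and B: "bounded_bilinear B" and "Ck_on k U g" "Ck_on k U h"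
  shows "Ck_on k U (\<lambda>x. B (g x) (h x))"
  using assms(3,4)
proof (induction k arbitrary: g h)
  case 0
  then show ?case by (auto intro: bounded_bilinear.continuous_on[OF B])
next
  case (Suc k)
  note k = Suc.prems[THEN Ck_on_SucD]
  show ?case
  proof (rule Ck_on_has_derivI[OF assms(1)])
    show "((\<lambda>x. B (g x) (h x)) has_derivative
        (\<lambda>v. B (g x) (frechet_derivative h (at x) v) + B (frechet_derivative g (at x) v) (h x))) (at x)"
      if "x \<in> U" for x
      by (rule bounded_bilinear.FDERIV[OF B]) (use Suc.prems that in \<open>blast intro: Ck_on_Suc_has_derivative\<close>)+
    show "Ck_on k U (\<lambda>x. B (g x) (frechet_derivative h (at x) v) + B (frechet_derivative g (at x) v) (h x))" for v
      by (intro Ck_on_add assms(1) Suc.IH k Suc.prems[THEN Ck_on_Suc_frechet])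
  qed
qed

text \<open>In the chain rule the derivative of \<open>g\<close> is applied to a direction that moves with \<open>x\<close>, while the
  induction hypothesis covers fixed directions only. Expanding the moving direction in the standard
  basis leaves fixed directions with coefficients of class \<open>C\<^sup>k\<close>.\<close>

lemma Ck_on_compose:
  fixes h :: "'a::euclidean_space \<Rightarrow> 'b::euclidean_space" and g :: "'b \<Rightarrow> 'c::euclidean_space"
  assumes "open U" "h ` U \<subseteq> V" "Ck_on k U h" "Ck_on k V g"
  shows "Ck_on k U (\<lambda>x. g (h x))"
  using assms(3,4)
proof (induction k arbitrary: g)
  case 0
  then show ?case using assms(2) by (auto intro: continuous_on_compose2)
next
  case (Suc k)
  let ?D = "\<lambda>f x. frechet_derivative f (at x)"
  have ch: "((\<lambda>x. g (h x)) has_derivative (\<lambda>v. \<Sum>b\<in>Basis. (?D h x v \<bullet> b) *\<^sub>R ?D g (h x) b)) (at x)"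
    if "x \<in> U" for x
  proof -
    have g: "(g has_derivative ?D g (h x)) (at (h x))"
      using Suc.prems(2) assms(2) that by (intro Ck_on_Suc_has_derivative) auto
    then interpret G: linear "?D g (h x)"
      by (intro bounded_linear.linear has_derivative_bounded_linear)
    have rep: "?D g (h x) w = (\<Sum>b\<in>Basis. (w \<bullet> b) *\<^sub>R ?D g (h x) b)" for w
      by (subst euclidean_representation[of w, symmetric]) (simp only: G.sum G.scaleR)
    have "((\<lambda>x. g (h x)) has_derivative (\<lambda>v. ?D g (h x) (?D h x v))) (at x)"
      using has_derivative_compose[OF Ck_on_Suc_has_derivative[OF Suc.prems(1) that] g] .
    moreover have "(\<lambda>v. ?D g (h x) (?D h x v)) = (\<lambda>v. \<Sum>b\<in>Basis. (?D h x v \<bullet> b) *\<^sub>R ?D g (h x) b)"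
      by (rule ext, rule rep)
    ultimately show ?thesis by (rule has_derivative_eq_rhs)
  qed
  show ?case
  proof (rule Ck_on_has_derivI[OF assms(1) ch])
    fix v
    have "Ck_on k U (\<lambda>x. ?D h x v)" "\<And>b. Ck_on k U (\<lambda>x. ?D g (h x) b)"
      by (rule Ck_on_Suc_frechet[OF Suc.prems(1)])
        (rule Suc.IH[OF Ck_on_SucD[OF Suc.prems(1)] Ck_on_Suc_frechet[OF Suc.prems(2)]])
    then show "Ck_on k U (\<lambda>x. \<Sum>b\<in>Basis. (?D h x v \<bullet> b) *\<^sub>R ?D g (h x) b)"
      by (intro Ck_on_sum Ck_on_bilinear[OF _ bounded_bilinear_scaleR]
          Ck_on_compose_bounded_linear[OF _ bounded_linear_inner_left] assms(1))
  qed
qed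

lemma Ck_on_SucI_real:
  fixes h h' :: "real \<Rightarrow> real"
  assumes "open U" "\<And>x. x \<in> U \<Longrightarrow> (h has_real_derivative h' x) (at x)" "Ck_on k U h'"
  shows "Ck_on (Suc k) U h"
proof (rule Ck_on_has_derivI[OF assms(1)])
  show "(h has_derivative (*) (h' x)) (at x)" if "x \<in> U" for x
    using assms(2)[OF that] by (simp add: has_field_derivative_def)
  show "Ck_on k U (\<lambda>x. h' x * v)" for v
    by (rule Ck_on_compose_bounded_linear[OF assms(1) bounded_linear_mult_left assms(3)])
qed

text \<open>Up to constant factors, the powers of \<open>x\<close> form a family closed under differentiation, so the
  induction runs over all exponents at once. The exponents of interest are \<open>1/2\<close> and \<open>-1/2\<close>.\<close>

lemma smooth_on_powr: "smooth_on {0<..} (\<lambda>x::real. x powr a)"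
proof -
  have "Ck_on k {0<..} (\<lambda>x::real. x powr a)" for k
  proof (induction k arbitrary: a)
    case 0
    then show ?case by (auto intro!: continuous_intros)
  next
    case (Suc k)
    show ?case
      by (rule Ck_on_SucI_real[where h' = "\<lambda>x. a * x powr (a - 1)"])
         (auto intro!: derivative_eq_intros Ck_on_compose_bounded_linear[OF _ bounded_linear_mult_right] Suc
           simp del: Ck_on.simps)
  qed
  then show ?thesis by (simp add: smooth_on_def)
qed

lemma smooth_on_has_real_derivative:
  fixes h :: "real \<Rightarrow> real"
  assumes "smooth_on U h" "x \<in> U"
  shows "(h has_real_derivative deriv h x) (at x)"
proof -
  have "Ck_on (Suc 0) U h" using assms(1) unfolding smooth_on_def by blast
  then have "h differentiable at x" using assms(2) by simp
  then show ?thesis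
    using DERIV_deriv_iff_real_differentiable by blast
qed

lemma smooth_on_deriv:
  fixes h :: "real \<Rightarrow> real"
  assumes "open U" "smooth_on U h"
  shows "smooth_on U (deriv h)"
  unfolding smooth_on_def
proof
  fix k
  have "Ck_on (Suc k) U h" using assms(2) unfolding smooth_on_def by blast
  then have D: "Ck_on k U (\<lambda>x. frechet_derivative h (at x) 1)" by (rule Ck_on_Suc_frechet)
  have "deriv h x = frechet_derivative h (at x) 1" if "x \<in> U" for x
  proof -
    have "(h has_derivative (*) (deriv h x)) (at x)"
      using smooth_on_has_real_derivative[OF assms(2) that] by (simp add: has_field_derivative_def)
    from frechet_derivative_at[OF this, symmetric] show ?thesis by simp
  qed
  then show "Ck_on k U (deriv h)" by (rule Ck_on_cong[OF assms(1) _ D])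
qed

section \<open>The profile function\<close>

lemma bigo_tendsto_0:
  fixes f g :: "'a \<Rightarrow> real"
  assumes "f \<in> O[F](g)" "(g \<longlongrightarrow> 0) F"
  shows "(f \<longlongrightarrow> 0) F"
proof -
  obtain c where "\<forall>\<^sub>F x in F. norm (f x) \<le> c * norm (g x)"
    using assms(1) by (auto elim: landau_o.bigE)
  moreover have "((\<lambda>x. c * norm (g x)) \<longlongrightarrow> 0) F"
    using tendsto_mult_right_zero[OF tendsto_norm_zero[OF assms(2)]] .
  ultimately show ?thesis by (rule Lim_null_comparison)
qed

lemma deriv_pos_imp_strict_mono:
  fixes h h' :: "real \<Rightarrow> real"
  assumes "\<And>x. x > 0 \<Longrightarrow> (h has_real_derivative h' x) (at x)" "\<And>x. x > 0 \<Longrightarrow> h' x > 0"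
    and "0 < x" "x < y"
  shows "h x < h y"
proof (rule DERIV_pos_imp_increasing[OF assms(4)])
  fix t assume "x \<le> t"
  then have "0 < t" using assms(3) by simp
  then show "\<exists>D. (h has_real_derivative D) (at t) \<and> D > 0" using assms(1,2) by blast
qed

text \<open>These hypotheses make \<open>f\<close> positive and strictly superadditive, and \<open>eta f\<close> a bijection of the
  half-line onto the real line.\<close>

locale profile =
  fixes f :: "real \<Rightarrow> real"
  assumes smooth: "smooth_on {0<..} f"
    and small: "f \<in> O[at_right 0](\<lambda>x. x ^ 2)"
    and deriv_small: "deriv f \<in> O[at_right 0](\<lambda>x. x)"
    and growth: "f \<in> O[at_top](\<lambda>x. x ^ 2)"
    and convex: "\<And>x. x > 0 \<Longrightarrow> deriv (deriv f) x > 0"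
begin

lemma deriv_f: "x > 0 \<Longrightarrow> (f has_real_derivative deriv f x) (at x)"
  using smooth_on_has_real_derivative[OF smooth] by simp

lemma deriv_strict_mono: "0 < x \<Longrightarrow> x < y \<Longrightarrow> deriv f x < deriv f y"
  by (rule deriv_pos_imp_strict_mono[OF smooth_on_has_real_derivative[OF smooth_on_deriv[OF open_greaterThan smooth]] convex])
    auto


text \<open>Convexity makes \<open>deriv f\<close> strictly increasing, and by the growth condition it starts from the
  limit \<open>0\<close> at the origin.\<close>

lemma deriv_pos:
  assumes "x > 0"
  shows "deriv f x > 0"
proof -
  have lim: "(deriv f \<longlongrightarrow> 0) (at_right 0)"
    by (rule bigo_tendsto_0[OF deriv_small]) (rule tendsto_ident_at)
  have "\<forall>\<^sub>F t in at_right 0. deriv f t \<le> deriv f (x / 2)"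
    unfolding eventually_at_right_field
  proof (intro exI[of _ "x / 2"] conjI allI impI)
    show "deriv f t \<le> deriv f (x / 2)" if "0 < t" "t < x / 2" for t
      using deriv_strict_mono[OF that] by simp
  qed (use assms in simp)
  then have "0 \<le> deriv f (x / 2)"
    by (rule tendsto_upperbound[OF lim]) simp
  also have "\<dots> < deriv f x"
    using assms by (intro deriv_strict_mono) auto
  finally show ?thesis .
qed

lemma f_tendsto_0: "(f \<longlongrightarrow> 0) (at_right 0)"
proof (rule bigo_tendsto_0[OF small])
  have "((\<lambda>x::real. x\<^sup>2) \<longlongrightarrow> 0\<^sup>2) (at_right 0)" by (intro tendsto_intros)
  then show "((\<lambda>x::real. x\<^sup>2) \<longlongrightarrow> 0) (at_right 0)" by simp
qed

lemma f_strict_mono: "0 < x \<Longrightarrow> x < y \<Longrightarrow> f x < f y"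
  by (rule deriv_pos_imp_strict_mono[OF deriv_f deriv_pos])

lemma f_pos:
  assumes "x > 0"
  shows "f x > 0"
proof -
  have "\<forall>\<^sub>F t in at_right 0. f t \<le> f (x / 2)"
    unfolding eventually_at_right_field
  proof (intro exI[of _ "x / 2"] conjI allI impI)
    show "f t \<le> f (x / 2)" if "0 < t" "t < x / 2" for t
      using f_strict_mono[OF that] by simp
  qed (use assms in simp)
  then have "0 \<le> f (x / 2)"
    by (rule tendsto_upperbound[OF f_tendsto_0]) simp
  also have "\<dots> < f x"
    using assms by (intro f_strict_mono) auto
  finally show ?thesis .
qed

lemma mean_value:
  assumes "0 < x" "x < y"
  obtains c where "x < c" "c < y" "f y - f x = (y - x) * deriv f c"
  using MVT2[of x y f "deriv f"] assms deriv_f by auto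

text \<open>A convex function lies above its tangent at \<open>x\<close>. Since \<open>f\<close> tends to zero at the origin, this
  tangent is nonpositive there.\<close>

lemma f_le_tangent:
  assumes "x > 0"
  shows "f x \<le> x * deriv f x"
proof -
  have "\<forall>\<^sub>F t in at_right 0. f x - (x - t) * deriv f x \<le> f t"
    unfolding eventually_at_right_field
  proof (intro exI[of _ x] conjI allI impI)
    fix t assume t: "0 < t" "t < x"
    then obtain c where c: "t < c" "c < x" "f x - f t = (x - t) * deriv f c"
      by (rule mean_value)
    have "deriv f c \<le> deriv f x" using deriv_strict_mono[of c x] c(1,2) t by simp
    then have "(x - t) * deriv f c \<le> (x - t) * deriv f x" using t by (intro mult_left_mono) auto
    then show "f x - (x - t) * deriv f x \<le> f t" using c(3) by linarith
  qed (use assms in simp)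
  moreover have "((\<lambda>t. f x - (x - t) * deriv f x) \<longlongrightarrow> f x - (x - 0) * deriv f x) (at_right 0)"
    by (intro tendsto_intros)
  ultimately have "f x - (x - 0) * deriv f x \<le> 0"
    by (intro tendsto_le[OF _ f_tendsto_0]) auto
  then show ?thesis by simp
qed

text \<open>The quotient \<open>f x / x\<close> increases strictly: by the mean value theorem the increment of \<open>f\<close>
  beyond \<open>x\<close> has a slope larger than that of the tangent at \<open>x\<close>, which is at least \<open>f x / x\<close>.\<close>

lemma f_star_shaped:
  assumes "0 < x" "x < y"
  shows "f x < x / y * f y"
proof -
  obtain c where c: "x < c" "c < y" "f y - f x = (y - x) * deriv f c"
    using assms by (rule mean_value)
  have "f x / x \<le> deriv f x" using f_le_tangent[OF assms(1)] assms(1) by (simp add: field_simps)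
  also have "\<dots> < deriv f c" using c assms by (intro deriv_strict_mono)
  finally have "(y - x) * (f x / x) < f y - f x"
    unfolding c(3) using assms by (intro mult_strict_left_mono) auto
  then show ?thesis using assms by (simp add: field_simps)
qed

text \<open>Each of at least two positive terms is strictly smaller than their sum \<open>X\<close>, hence
  \<open>f (x i) < x i / X * f X\<close>, and the right-hand sides add up to \<open>f X\<close>. This inequality is what
  makes the hypersurface spacelike.\<close>

lemma f_superadditive:
  fixes x :: "'i \<Rightarrow> real"
  assumes "card I \<ge> 2" and pos: "\<And>i. i \<in> I \<Longrightarrow> 0 < x i"
  shows "(\<Sum>i\<in>I. f (x i)) < f (\<Sum>i\<in>I. x i)"
proof -
  have I: "finite I" "I \<noteq> {}" using assms(1) by (auto intro: card_ge_0_finite)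
  let ?X = "\<Sum>i\<in>I. x i"
  have "x i < ?X" if i: "i \<in> I" for i
  proof -
    have "card (I - {i}) \<noteq> 0" using assms(1) i I by simp
    then have "0 < (\<Sum>j\<in>I - {i}. x j)" using I pos by (intro sum_pos) auto
    then show ?thesis using sum.remove[OF I(1) i, of x] by simp
  qed
  then have "(\<Sum>i\<in>I. f (x i)) < (\<Sum>i\<in>I. x i / ?X * f ?X)"
    using I pos by (intro sum_strict_mono f_star_shaped) auto
  also have "\<dots> = f ?X"
    using sum_pos[OF I, of x] pos by (simp add: sum_distrib_right[symmetric] sum_divide_distrib[symmetric])
  finally show ?thesis .
qed

section \<open>The coordinate change and its inverse\<close>

lemma eta_deriv:
  assumes "x > 0"
  shows "(eta f has_real_derivative 1 / sqrt (f x)) (at x)"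
proof -
  (* a compact interval in the half-line with both x and the base point 1 in its interior *)
  define a b where "a = min x 1 / 2" and "b = max x 1 + 1"
  have ab: "0 < a" "a < x" "x < b" "a < 1" "1 < b" using assms by (auto simp: a_def b_def)
  have "continuous_on {a..b} f"
    using ab by (intro continuous_at_imp_continuous_on ballI DERIV_isCont[OF deriv_f]) auto
  moreover have "sqrt (f r) \<noteq> 0" if "r \<in> {a..b}" for r
    using f_pos[of r] that ab by simp
  ultimately have "continuous_on {a..b} (\<lambda>r. 1 / sqrt (f r))"
    by (intro continuous_intros) auto
  from interval_integral_FTC2[OF _ _ this, of 1 x]
  have "(eta f has_vector_derivative 1 / sqrt (f x)) (at x within {a..b})"
    using ab by (simp add: eta_def[abs_def])
  moreover have "at x within {a..b} = at x"
    using ab by (intro at_within_interior) auto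
  ultimately show ?thesis
    by (simp add: has_real_derivative_iff_has_vector_derivative)
qed

lemma eta_strict_mono: "0 < x \<Longrightarrow> x < y \<Longrightarrow> eta f x < eta f y"
  by (rule deriv_pos_imp_strict_mono[OF eta_deriv]) (auto intro: f_pos)

text \<open>Where \<open>f\<close> is at most quadratic, the integrand \<open>1 / sqrt (f r)\<close> dominates a multiple of \<open>1 / r\<close>,
  so \<open>eta f\<close> grows at least like a logarithm. Used near infinity and near zero, this makes
  \<open>eta f\<close> unbounded in both directions.\<close>

lemma eta_ge_ln:
  assumes "0 < a" "a \<le> b" "c > 0" and le: "\<And>x. a \<le> x \<Longrightarrow> x \<le> b \<Longrightarrow> f x \<le> c * x\<^sup>2"
  shows "(ln b - ln a) / sqrt c \<le> eta f b - eta f a"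
proof -
  have "eta f a - ln a / sqrt c \<le> eta f b - ln b / sqrt c"
  proof (rule DERIV_nonneg_imp_nondecreasing[OF assms(2)])
    fix x assume x: "a \<le> x" "x \<le> b"
    then have pos: "0 < x" "0 < f x" using assms(1) f_pos by auto
    have "sqrt (f x) \<le> sqrt (c * x\<^sup>2)" using le[OF x] by simp
    also have "\<dots> = sqrt c * x" using pos by (simp add: real_sqrt_mult)
    finally have "1 / (sqrt c * x) \<le> 1 / sqrt (f x)" using pos by (intro frac_le) auto
    moreover have "((\<lambda>x. eta f x - ln x / sqrt c) has_real_derivative 1 / sqrt (f x) - 1 / (sqrt c * x)) (at x)"
      using pos assms(3) by (auto intro!: derivative_eq_intros eta_deriv simp: field_simps)
    ultimately show "\<exists>y. ((\<lambda>x. eta f x - ln x / sqrt c) has_real_derivative y) (at x) \<and> 0 \<le> y"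
      by (intro exI conjI) auto
  qed
  then show ?thesis by (simp add: diff_divide_distrib)
qed

lemma eta_unbounded_above: "\<exists>x>0. y \<le> eta f x"
proof -
  obtain c where c: "c > 0" "\<forall>\<^sub>F x in at_top. norm (f x) \<le> c * norm (x\<^sup>2)"
    using growth by (auto elim: landau_o.bigE)
  then obtain N where N: "\<And>x. x \<ge> N \<Longrightarrow> f x \<le> c * x\<^sup>2"
    unfolding eventually_at_top_linorder by fastforce
  define a where "a = max N 1"
  (* so far out that the logarithmic lower bound covers the distance from eta f a up to y *)
  define b where "b = max a (exp ((y - eta f a) * sqrt c + ln a))"
  have a: "0 < a" by (simp add: a_def)
  have "ln b \<ge> ln (exp ((y - eta f a) * sqrt c + ln a))"
    by (rule ln_mono) (auto simp: b_def)
  then have "y - eta f a \<le> (ln b - ln a) / sqrt c"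
    using c(1) by (simp add: field_simps)
  also have "\<dots> \<le> eta f b - eta f a"
    by (rule eta_ge_ln) (use a c(1) N in \<open>auto simp: b_def a_def\<close>)
  finally show ?thesis using a by (intro exI[of _ b]) (auto simp: b_def)
qed

lemma eta_unbounded_below: "\<exists>x>0. eta f x \<le> y"
proof -
  obtain c where c: "c > 0" "\<forall>\<^sub>F x in at_right 0. norm (f x) \<le> c * norm (x\<^sup>2)"
    using small by (auto elim: landau_o.bigE)
  then obtain d where d: "d > 0" "\<And>x. 0 < x \<Longrightarrow> x < d \<Longrightarrow> f x \<le> c * x\<^sup>2"
    unfolding eventually_at_right_field by fastforce
  define b where "b = d / 2"
  (* so close to zero that the logarithmic lower bound covers the distance from eta f b down to y *)
  define a where "a = min b (exp (ln b - (eta f b - y) * sqrt c))"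
  have b: "0 < b" "b < d" using d(1) by (auto simp: b_def)
  have a: "0 < a" "a \<le> b" using b by (auto simp: a_def)
  have "ln a \<le> ln (exp (ln b - (eta f b - y) * sqrt c))"
    using a(1) by (intro ln_mono) (auto simp: a_def)
  then have "eta f b - y \<le> (ln b - ln a) / sqrt c"
    using c(1) by (simp add: field_simps)
  also have "\<dots> \<le> eta f b - eta f a"
    by (rule eta_ge_ln) (use a b c(1) d in auto)
  finally show ?thesis using a by (intro exI[of _ a]) auto
qed

lemma bij_eta: "bij_betw (eta f) {0<..} UNIV"
  unfolding bij_betw_def
proof
  show "inj_on (eta f) {0<..}"
    using eta_strict_mono by (intro linorder_inj_onI) (auto dest: less_imp_neq)
  have "\<exists>x>0. eta f x = y" for y
  proof -
    obtain a b where ab: "0 < a" "eta f a \<le> y" "0 < b" "y \<le> eta f b"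
      using eta_unbounded_above eta_unbounded_below by blast
    have "a \<le> b" using ab eta_strict_mono[of b a] by (cases "a \<le> b") auto
    moreover have "continuous_on {a..b} (eta f)"
      using ab(1) by (intro continuous_at_imp_continuous_on ballI DERIV_isCont[OF eta_deriv]) auto
    ultimately obtain x where "a \<le> x" "eta f x = y" using IVT'[of "eta f" a y b] ab by auto
    then show ?thesis using ab(1) by (intro exI[of _ x]) auto
  qed
  then show "eta f ` {0<..} = UNIV" by (metis UNIV_eq_I greaterThan_iff image_eqI)
qed

lemma xi_pos: "0 < xi f y"
  using inv_into_into[of y "eta f" "{0<..}"] bij_eta by (auto simp: xi_def bij_betw_def)

lemma eta_xi: "eta f (xi f y) = y"
  using bij_eta unfolding xi_def by (intro f_inv_into_f) (auto simp: bij_betw_def)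

lemma xi_eta: "0 < x \<Longrightarrow> xi f (eta f x) = x"
  using bij_eta by (auto simp: xi_def bij_betw_def)

text \<open>The derivative is the reciprocal of that of \<open>\<eta>\<close> at \<open>\<xi> y\<close>. Read as an autonomous differential
  equation for \<open>\<xi>\<close>, it is what drives the induction for smoothness below.\<close>

lemma xi_deriv: "(xi f has_real_derivative sqrt (f (xi f y))) (at y)"
proof -
  have "isCont (xi f) (eta f (xi f y))"
    by (rule isCont_inverse_function2[where a = "xi f y / 2" and b = "xi f y + 1"])
      (use xi_pos[of y] in \<open>auto intro!: xi_eta DERIV_isCont[OF eta_deriv]\<close>)
  then have "isCont (xi f) y" by (simp add: eta_xi)
  then have "(xi f has_real_derivative inverse (1 / sqrt (f (xi f y)))) (at y)"
    using f_pos[OF xi_pos[of y]]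
    by (intro DERIV_inverse_function[where f = "eta f" and a = "y - 1" and b = "y + 1"] eta_deriv xi_pos)
      (auto simp: eta_xi)
  then show ?thesis by simp
qed

lemma smooth_f_powr: "smooth_on {0<..} (\<lambda>x. f x powr a)"
  unfolding smooth_on_def
proof
  show "Ck_on k {0<..} (\<lambda>x. f x powr a)" for k
    by (rule Ck_on_compose[where V = "{0<..}" and g = "\<lambda>x. x powr a"])
      (use smooth smooth_on_powr[of a] f_pos in \<open>auto simp: smooth_on_def\<close>)
qed

lemma smooth_eta: "smooth_on {0<..} (eta f)"
proof -
  have "Ck_on k {0<..} (\<lambda>x. 1 / sqrt (f x))" for k
  proof (rule Ck_on_cong)
    show "Ck_on k {0<..} (\<lambda>x. f x powr (- (1 / 2)))"
      using smooth_f_powr by (simp add: smooth_on_def)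
    show "1 / sqrt (f x) = f x powr (- (1 / 2))" if "x \<in> {0<..}" for x
      using f_pos[of x] that by (simp add: powr_minus_divide powr_half_sqrt)
  qed simp
  then have "Ck_on (Suc k) {0<..} (eta f)" for k
    using eta_deriv by (intro Ck_on_SucI_real[where h' = "\<lambda>x. 1 / sqrt (f x)"]) auto
  from this[THEN Ck_on_SucD] show ?thesis by (simp add: smooth_on_def)
qed

text \<open>Bootstrapping: in the differential equation for \<open>\<xi>\<close> the right-hand side is as regular as \<open>\<xi>\<close>
  itself, so \<open>\<xi>\<close> is one degree more regular.\<close>

lemma smooth_xi: "smooth_on UNIV (xi f)"
proof -
  have "Ck_on k UNIV (xi f)" for k
  proof (induction k)
    case 0
    then show ?case
      using xi_deriv by (auto intro!: continuous_at_imp_continuous_on DERIV_isCont)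
  next
    case (Suc k)
    have "Ck_on k {0<..} (\<lambda>x. sqrt (f x))"
      by (rule Ck_on_cong[where h = "\<lambda>x. f x powr (1 / 2)"])
        (use smooth_f_powr f_pos in \<open>auto simp: smooth_on_def powr_half_sqrt less_imp_le\<close>)
    then have "Ck_on k UNIV (\<lambda>y. sqrt (f (xi f y)))"
      using xi_pos Suc by (intro Ck_on_compose[where g = "\<lambda>x. sqrt (f x)" and h = "xi f" and V = "{0<..}"]) auto
    then show ?case
      using xi_deriv by (intro Ck_on_SucI_real[where h' = "\<lambda>y. sqrt (f (xi f y))"]) auto
  qed
  then show ?thesis by (simp add: smooth_on_def)
qed

end

section \<open>Graphs of smooth maps\<close>

text \<open>For \<open>c = -1\<close> this shear flattens the graph of \<open>G\<close>, and for \<open>c = 1\<close> it is the inverse map.\<close>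

lemma smooth_on_graph_shear:
  fixes G :: "'a::euclidean_space \<Rightarrow> 'b::euclidean_space"
  assumes "smooth_on UNIV G"
  shows "smooth_on UNIV (\<lambda>p. (fst p, snd p + c *\<^sub>R G (fst p)))"
  unfolding smooth_on_def
proof
  fix k
  have "Ck_on k UNIV (\<lambda>p::'a \<times> 'b. G (fst p))"
    by (rule Ck_on_compose[where g = G and V = UNIV])
      (use assms in \<open>auto simp: smooth_on_def intro: Ck_on_bounded_linear bounded_linear_fst\<close>)
  then have "Ck_on k UNIV (\<lambda>p::'a \<times> 'b. c *\<^sub>R G (fst p))"
    by (rule Ck_on_compose_bounded_linear[OF open_UNIV bounded_linear_scaleR_right])
  then show "Ck_on k UNIV (\<lambda>p. (fst p, snd p + c *\<^sub>R G (fst p)))"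
    by (intro Ck_on_Pair Ck_on_add Ck_on_bounded_linear[OF _ bounded_linear_fst]
        Ck_on_bounded_linear[OF _ bounded_linear_snd] open_UNIV)
qed

text \<open>The shear \<open>\<phi>\<close> is a single global slice chart.\<close>

lemma graph_smooth_submanifold:
  fixes G :: "'a::euclidean_space \<Rightarrow> 'b::euclidean_space"
  assumes G: "smooth_on UNIV G"
  shows "smooth_submanifold DIM('b) {p. snd p = G (fst p)}"
proof -
  define \<phi> :: "'a \<times> 'b \<Rightarrow> 'a \<times> 'b" where "\<phi> p = (fst p, snd p - G (fst p))" for p
  define \<psi> :: "'a \<times> 'b \<Rightarrow> 'a \<times> 'b" where "\<psi> p = (fst p, snd p + G (fst p))" for p
  define L :: "('a \<times> 'b) set" where "L = range (\<lambda>v. (v, 0))"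
  have \<phi>\<psi>: "\<phi> (\<psi> p) = p" "\<psi> (\<phi> p) = p" for p by (simp_all add: \<phi>_def \<psi>_def)
  then have bij: "bij \<phi>" by (metis bijI')
  have inv: "inv \<phi> = \<psi>" using \<phi>\<psi> by (metis inv_unique_comp ext comp_apply id_apply)
  have "smooth_on UNIV \<phi>" "smooth_on UNIV \<psi>"
    using smooth_on_graph_shear[OF G, of "-1"] smooth_on_graph_shear[OF G, of 1]
    by (simp_all add: \<phi>_def[abs_def] \<psi>_def[abs_def])
  then have diffeo: "smooth_diffeo UNIV UNIV \<phi>"
    by (simp add: smooth_diffeo_def bij inv)
  have lin: "linear (\<lambda>v::'a. (v, 0::'b))"
    by (rule linearI) auto
  have sub: "subspace L"
    unfolding L_def by (rule linear_subspace_image[OF lin subspace_UNIV])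
  have "dim L = DIM('a)"
    unfolding L_def by (subst dim_image_eq[OF lin]) (auto simp: inj_on_def)
  then have dim: "dim L + DIM('b) = DIM('a \<times> 'b)" by simp
  have "\<phi> ` {p. snd p = G (fst p)} = L"
  proof
    show "\<phi> ` {p. snd p = G (fst p)} \<subseteq> L" by (auto simp: \<phi>_def L_def)
    show "L \<subseteq> \<phi> ` {p. snd p = G (fst p)}"
    proof
      fix q assume "q \<in> L"
      then have "q = \<phi> (\<psi> q)" "snd (\<psi> q) = G (fst (\<psi> q))"
        by (simp_all add: \<phi>\<psi>) (auto simp: \<psi>_def L_def)
      then show "q \<in> \<phi> ` {p. snd p = G (fst p)}" by blast
    qed
  qed
  then have "\<phi> ` ({p. snd p = G (fst p)} \<inter> UNIV) = L \<inter> UNIV" by simp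
  then show ?thesis
    unfolding smooth_submanifold_def using diffeo sub dim by blast
qed

text \<open>The equation of the graph differentiates along any curve in it, which gives one inclusion. For the
  other, a line in the base lifts to the graph with the prescribed velocity.\<close>

lemma graph_tangent_space:
  fixes G :: "'a::euclidean_space \<Rightarrow> 'b::euclidean_space"
  assumes G: "smooth_on UNIV G" and D: "(G has_derivative D) (at (fst p))" and p: "snd p = G (fst p)"
  shows "tangent_space {p. snd p = G (fst p)} p = {v. snd v = D (fst v)}"
proof (intro equalityI subsetI)
  fix v assume "v \<in> tangent_space {p. snd p = G (fst p)} p"
  then obtain \<epsilon> \<gamma> where e: "0 < \<epsilon>" "\<gamma> ` {-\<epsilon><..<\<epsilon>} \<subseteq> {p. snd p = G (fst p)}" "\<gamma> 0 = p"
    and \<gamma>: "(\<gamma> has_derivative (\<lambda>t. t *\<^sub>R v)) (at 0)"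
    unfolding tangent_space_def has_vector_derivative_def by blast
  have "((\<lambda>t. G (fst (\<gamma> t))) has_derivative (\<lambda>t. D (fst (t *\<^sub>R v)))) (at 0)"
    by (rule has_derivative_compose[OF has_derivative_fst[OF \<gamma>]]) (simp add: e(3) D)
  then have "((\<lambda>t. snd (\<gamma> t)) has_derivative (\<lambda>t. D (fst (t *\<^sub>R v)))) (at 0)"
    by (rule has_derivative_transform_within_open[of _ _ _ _ "{-\<epsilon><..<\<epsilon>}"])
      (use e(1,2) in \<open>auto simp: image_subset_iff\<close>)
  from has_derivative_unique[OF has_derivative_snd[OF \<gamma>] this]
  have "snd (1 *\<^sub>R v) = D (fst (1 *\<^sub>R v))" by (rule fun_cong)
  then show "v \<in> {v. snd v = D (fst v)}" by simp
next
  fix v assume v: "v \<in> {v. snd v = D (fst v)}"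
  define \<gamma> where "\<gamma> t = (fst p + t *\<^sub>R fst v, G (fst p + t *\<^sub>R fst v))" for t :: real
  have "Ck_on k {-1<..<1} \<gamma>" for k
  proof -
    have line: "Ck_on k {-1<..<1} (\<lambda>t::real. fst p + t *\<^sub>R fst v)"
      by (intro Ck_on_add Ck_on_const Ck_on_bounded_linear bounded_linear_scaleR_left) auto
    then have "Ck_on k {-1<..<1} (\<lambda>t::real. G (fst p + t *\<^sub>R fst v))"
      by (rule Ck_on_compose[where g = G and V = UNIV, rotated 2])
        (use G in \<open>auto simp: smooth_on_def\<close>)
    with line show ?thesis
      unfolding \<gamma>_def by (intro Ck_on_Pair) auto
  qed
  then have smooth: "smooth_on {-1<..<1} \<gamma>" by (simp add: smooth_on_def)
  have line: "((\<lambda>t::real. fst p + t *\<^sub>R fst v) has_derivative (\<lambda>t. t *\<^sub>R fst v)) (at 0)"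
    by (auto intro!: derivative_eq_intros)
  have "((\<lambda>t. G (fst p + t *\<^sub>R fst v)) has_derivative (\<lambda>t. D (t *\<^sub>R fst v))) (at 0)"
    by (rule has_derivative_compose[OF line]) (simp add: D)
  from has_derivative_Pair[OF line this]
  have "(\<gamma> has_vector_derivative v) (at 0)"
    using v linear_scale[OF has_derivative_linear[OF D]]
    by (simp add: \<gamma>_def[abs_def] has_vector_derivative_def scaleR_prod_def)
  then show "v \<in> tangent_space {p. snd p = G (fst p)} p"
    unfolding tangent_space_def using smooth p
    by (intro CollectI exI[of _ "1::real"] exI[of _ \<gamma>]) (auto simp: \<gamma>_def prod_eq_iff)
qed

section \<open>The metric induced by Minkowski space\<close>

text \<open>Through this formula, bilinearity and smoothness of the Minkowski product follow from those of the
  Euclidean inner product.\<close>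

lemma minkowski_eq_inner: "minkowski v w = inner v (fst w, - snd w)"
  by (simp add: minkowski_def inner_prod_def inner_vec_def)

lemma bounded_bilinear_minkowski: "bounded_bilinear minkowski"
proof -
  have "bounded_linear (\<lambda>w::'a::finite minkowski_space. (fst w, - snd w))"
    by (intro bounded_linear_Pair bounded_linear_minus bounded_linear_fst bounded_linear_snd)
  from bounded_bilinear.comp[OF bounded_bilinear_inner bounded_linear_ident this]
  show ?thesis by (simp add: minkowski_eq_inner[abs_def])
qed

text \<open>The tangent spaces have to be linear subspaces because the induced metric is undefined outside them,
  and additivity evaluates it at linear combinations of tangent vectors. Smoothness is inherited from
  local extensions of the two vector fields, to which the constant Minkowski product is applied.\<close>

lemma riemannian_induced_metric:
  fixes S :: "'n::finite minkowski_space set"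
  assumes sub: "\<And>p. p \<in> S \<Longrightarrow> subspace (tangent_space S p)"
    and pos: "\<And>p v. p \<in> S \<Longrightarrow> v \<in> tangent_space S p \<Longrightarrow> v \<noteq> 0 \<Longrightarrow> minkowski v v > 0"
  shows "riemannian_metric S (induced_metric S)"
  unfolding riemannian_metric_def
proof (intro conjI allI ballI impI)
  interpret B: bounded_bilinear "minkowski :: 'n minkowski_space \<Rightarrow> _"
    by (rule bounded_bilinear_minkowski)
  fix p u v w and a b :: real
  assume "p \<in> S" "u \<in> tangent_space S p" "v \<in> tangent_space S p" "w \<in> tangent_space S p"
  moreover from this have "a *\<^sub>R u + b *\<^sub>R v \<in> tangent_space S p"
    using sub by (intro subspace_add subspace_scale) auto
  ultimately show "induced_metric S p (a *\<^sub>R u + b *\<^sub>R v) w =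
      a * induced_metric S p u w + b * induced_metric S p v w"
    by (simp add: induced_metric_def B.add_left B.scaleR_left)
next
  fix p v w
  assume "p \<in> S" "v \<in> tangent_space S p" "w \<in> tangent_space S p"
  then show "induced_metric S p v w = induced_metric S p w v"
    by (simp add: induced_metric_def minkowski_def mult.commute)
next
  fix p v
  assume "p \<in> S" "v \<in> tangent_space S p" "v \<noteq> 0"
  then show "0 < induced_metric S p v v"
    using pos by (simp add: induced_metric_def)
next
  fix U X Y
  assume X: "smooth_on_subset (S \<inter> U) X" and Y: "smooth_on_subset (S \<inter> U) Y"
    and tan: "\<forall>p\<in>S \<inter> U. X p \<in> tangent_space S p \<and> Y p \<in> tangent_space S p"
  show "smooth_on_subset (S \<inter> U) (\<lambda>p. induced_metric S p (X p) (Y p))"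
    unfolding smooth_on_subset_def
  proof
    fix p assume p: "p \<in> S \<inter> U"
    obtain V H where V: "open V" "p \<in> V" "smooth_on V H" "\<forall>q\<in>S \<inter> U \<inter> V. H q = X q"
      using X p unfolding smooth_on_subset_def by blast
    obtain W K where W: "open W" "p \<in> W" "smooth_on W K" "\<forall>q\<in>S \<inter> U \<inter> W. K q = Y q"
      using Y p unfolding smooth_on_subset_def by blast
    have "smooth_on (V \<inter> W) (\<lambda>q. minkowski (H q) (K q))"
      using V W Ck_on_subset[of _ V H "V \<inter> W"] Ck_on_subset[of _ W K "V \<inter> W"]
      by (auto simp: smooth_on_def intro!: Ck_on_bilinear[OF _ bounded_bilinear_minkowski])
    moreover have "\<forall>q\<in>S \<inter> U \<inter> (V \<inter> W). minkowski (H q) (K q) = induced_metric S q (X q) (Y q)"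
      using V W tan by (simp add: induced_metric_def)
    ultimately show "\<exists>V H. open V \<and> p \<in> V \<and> smooth_on V H \<and>
        (\<forall>q\<in>S \<inter> U \<inter> V. H q = induced_metric S q (X q) (Y q))"
      using V W by (intro exI[of _ "V \<inter> W"] exI[of _ "\<lambda>q. minkowski (H q) (K q)"]) auto
  qed
qed

text \<open>The vector \<open>c\<close> collects the slopes of a hyperplane through the origin, given as a graph over the
  spatial directions. When \<open>c\<close> is shorter than one, Cauchy-Schwarz makes the timelike component of a
  nonzero vector in the hyperplane smaller than its spatial length.\<close>

lemma minkowski_pos_of_slope:
  fixes c :: "'n::finite \<Rightarrow> real"
  assumes c: "(\<Sum>i\<in>UNIV. (c i)\<^sup>2) < 1" and v: "snd v = (\<Sum>i\<in>UNIV. fst v $ i * c i)" "v \<noteq> 0"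
  shows "minkowski v v > 0"
proof -
  have "fst v \<noteq> 0" using v by (auto simp: prod_eq_iff)
  then have "0 < inner (fst v) (fst v)" by simp
  then have pos: "0 < (\<Sum>i\<in>UNIV. (fst v $ i)\<^sup>2)" by (simp add: inner_vec_def power2_eq_square)
  have "(snd v)\<^sup>2 \<le> (\<Sum>i\<in>UNIV. (fst v $ i)\<^sup>2) * (\<Sum>i\<in>UNIV. (c i)\<^sup>2)"
    unfolding v(1) by (rule Cauchy_Schwarz_ineq_sum)
  also have "\<dots> < (\<Sum>i\<in>UNIV. (fst v $ i)\<^sup>2) * 1"
    using pos c by (intro mult_strict_left_mono)
  finally show ?thesis by (simp add: minkowski_def power2_eq_square)
qed

section \<open>The hypersurface\<close>

context profile
begin

definition height :: "real ^ 'n::finite \<Rightarrow> real" where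
  "height y = eta f (\<Sum>i\<in>UNIV. xi f (y $ i))"

text \<open>The coefficients are the timelike components of \<open>frame\<close>.\<close>

definition height_deriv :: "real ^ 'n::finite \<Rightarrow> real ^ 'n \<Rightarrow> real" where
  "height_deriv y v = (\<Sum>i\<in>UNIV. v $ i * sqrt (f (xi f (y $ i)) / f (xi f (height y))))"

lemma sum_xi_pos: "0 < (\<Sum>i\<in>UNIV. xi f ((y :: real ^ 'n::finite) $ i))"
  by (intro sum_pos xi_pos) auto

lemma xi_height: "xi f (height y) = (\<Sum>i\<in>UNIV. xi f (y $ i))"
  unfolding height_def by (rule xi_eta[OF sum_xi_pos])

text \<open>Substituting \<open>x\<^sub>i = \<xi> y\<^sub>i\<close> turns the parametrization into the equation of a graph.\<close>

lemma image_Phi: "Phi f ` pos_orthant = {y. snd y = height (fst y)}"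
proof (intro equalityI subsetI)
  fix y assume "y \<in> Phi f ` pos_orthant"
  then show "y \<in> {y. snd y = height (fst y)}"
    by (auto simp: Phi_def pos_orthant_def height_def xi_eta)
next
  fix y :: "'a minkowski_space" assume "y \<in> {y. snd y = height (fst y)}"
  then have "y = Phi f (\<chi> i. xi f (fst y $ i))"
    by (simp add: Phi_def height_def eta_xi prod_eq_iff vec_eq_iff)
  then show "y \<in> Phi f ` pos_orthant"
    by (rule image_eqI) (simp add: pos_orthant_def xi_pos)
qed

lemma smooth_height: "smooth_on UNIV (height :: real ^ 'n::finite \<Rightarrow> real)"
  unfolding smooth_on_def
proof
  fix k
  have "Ck_on k UNIV (\<lambda>y :: real ^ 'n. xi f (y $ i))" for i
    by (rule Ck_on_compose[where g = "xi f" and V = UNIV])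
      (use smooth_xi in \<open>auto simp: smooth_on_def intro: Ck_on_bounded_linear bounded_linear_vec_nth\<close>)
  then have "Ck_on k UNIV (\<lambda>y :: real ^ 'n. \<Sum>i\<in>UNIV. xi f (y $ i))"
    by (intro Ck_on_sum) auto
  then show "Ck_on k UNIV (height :: real ^ 'n \<Rightarrow> real)"
    unfolding height_def[abs_def]
    by (rule Ck_on_compose[where g = "eta f" and V = "{0<..}", rotated 2])
      (use smooth_eta sum_xi_pos in \<open>auto simp: smooth_on_def\<close>)
qed

lemma height_has_derivative: "(height has_derivative height_deriv y) (at y)"
proof -
  let ?X = "\<Sum>i\<in>UNIV. xi f (y $ i)"
  have X: "((\<lambda>y. \<Sum>i\<in>UNIV. xi f (y $ i)) has_derivative (\<lambda>v. \<Sum>i\<in>UNIV. sqrt (f (xi f (y $ i))) * v $ i)) (at y)"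
  proof (rule has_derivative_sum)
    fix i
    show "((\<lambda>y. xi f (y $ i)) has_derivative (\<lambda>v. sqrt (f (xi f (y $ i))) * v $ i)) (at y)"
      by (rule has_derivative_compose[OF bounded_linear_imp_has_derivative[OF bounded_linear_vec_nth]])
        (use xi_deriv in \<open>simp add: has_field_derivative_def\<close>)
  qed
  have "(height has_derivative (\<lambda>v. 1 / sqrt (f ?X) * (\<Sum>i\<in>UNIV. sqrt (f (xi f (y $ i))) * v $ i))) (at y)"
    unfolding height_def[abs_def]
    by (rule has_derivative_compose[OF X])
      (use eta_deriv[OF sum_xi_pos[of y]] in \<open>simp only: has_field_derivative_def\<close>)
  moreover have "(\<lambda>v. 1 / sqrt (f ?X) * (\<Sum>i\<in>UNIV. sqrt (f (xi f (y $ i))) * v $ i)) = height_deriv y"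
    by (rule ext) (simp add: height_deriv_def xi_height real_sqrt_divide sum_divide_distrib mult.commute)
  ultimately show ?thesis by (rule has_derivative_eq_rhs)
qed

text \<open>The squares are \<open>f (x\<^sub>i) / f X\<close> with \<open>x\<^sub>i = \<xi> y\<^sub>i\<close> and \<open>X\<close> the sum of the \<open>x\<^sub>i\<close>, so the bound
  is superadditivity of \<open>f\<close>.\<close>

lemma slope_sum_less_1:
  assumes "CARD('n::finite) \<ge> 2"
  shows "(\<Sum>i\<in>UNIV. (sqrt (f (xi f ((y :: real ^ 'n) $ i)) / f (xi f (height y))))\<^sup>2) < 1"
proof -
  have "(\<Sum>i\<in>UNIV. f (xi f (y $ i))) < f (xi f (height y))"
    unfolding xi_height by (rule f_superadditive) (use assms xi_pos in auto)
  moreover have "0 < f (xi f (height y))" by (intro f_pos xi_pos)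
  ultimately show ?thesis
    using f_pos[OF xi_pos] by (simp add: less_imp_le sum_divide_distrib[symmetric])
qed

text \<open>The frame is the image of the standard basis under the linear embedding \<open>v \<mapsto> (v, D v)\<close>, whose
  range is the tangent space of the graph.\<close>

lemma frame_basis:
  assumes "snd y = height (fst y)"
  shows "inj (frame f y) \<and> independent (range (frame f y)) \<and>
    span (range (frame f y)) = {v. snd v = height_deriv (fst y) (fst v)}"
proof -
  let ?D = "height_deriv (fst y)"
  define T where "T v = (v, ?D v)" for v
  have frame: "frame f y i = T (axis i 1)" for i
    by (simp add: frame_def T_def height_deriv_def assms axis_def if_distrib[of "\<lambda>x. x * _"] cong: if_cong)
  interpret D: linear ?D
    by (rule has_derivative_linear[OF height_has_derivative])
  have lin: "linear T"
    by (intro linearI) (simp_all add: T_def D.add D.scaleR)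
  have inj: "inj T" by (auto simp: T_def inj_on_def)
  have range: "range (frame f y) = T ` Basis"
    by (auto simp: frame Basis_vec_def image_iff)
  have "inj (frame f y)"
    by (auto intro!: injI dest!: injD[OF inj] simp: frame axis_eq_axis)
  moreover have "independent (range (frame f y))"
    unfolding range by (rule linear_independent_injective_image[OF lin independent_Basis inj_on_subset[OF inj subset_UNIV]])
  moreover have "span (range (frame f y)) = {v. snd v = ?D (fst v)}"
    unfolding range linear_span_image[OF lin] by (auto simp: T_def image_iff prod_eq_iff)
  ultimately show ?thesis by blast
qed

end

theorem proposition3:
  fixes f :: "real \<Rightarrow> real"
    and S :: "'n::finite minkowski_space set"
  assumes "CARD('n) \<ge> 2"
    and "smooth_on {0<..} f"
    and "f \<in> O[at_right 0](\<lambda>x. x ^ 2)"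
    and "deriv f \<in> O[at_right 0](\<lambda>x. x)"
    and "f \<in> O[at_top](\<lambda>x. x ^ 2)"
    and "\<And>x. x > 0 \<Longrightarrow> deriv (deriv f) x > 0"
    and "\<And>x. x > 0 \<Longrightarrow> deriv (deriv (\<lambda>t. f t / deriv f t)) x > 0"
    and "S = Phi f ` pos_orthant"
  shows "bij_betw (eta f) {0<..} UNIV
    \<and> smooth_submanifold 1 S
    \<and> S = {y. snd y = eta f (\<Sum>i\<in>UNIV. xi f (fst y $ i))}
    \<and> (\<forall>y\<in>S. \<forall>v\<in>tangent_space S y. v \<noteq> 0 \<longrightarrow> induced_metric S y v v > 0)
    \<and> riemannian_metric S (induced_metric S)
    \<and> (\<forall>y\<in>S. inj (frame f y) \<and> independent (range (frame f y)) \<and>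
         span (range (frame f y)) = tangent_space S y)"
proof -
  interpret profile f
    using assms(2-6) by unfold_locales
  have S: "S = {y. snd y = height (fst y)}"
    unfolding assms(8) by (rule image_Phi)
  have tangent: "tangent_space S y = {v. snd v = height_deriv (fst y) (fst v)}" if "y \<in> S" for y
    using that unfolding S by (intro graph_tangent_space smooth_height height_has_derivative) auto
  have frame: "inj (frame f y) \<and> independent (range (frame f y)) \<and>
      span (range (frame f y)) = tangent_space S y" if "y \<in> S" for y
    unfolding tangent[OF that] using that by (intro frame_basis) (simp add: S)
  have pos: "minkowski v v > 0" if "y \<in> S" "v \<in> tangent_space S y" "v \<noteq> 0" for y v
    using that tangent[OF that(1)]
    by (intro minkowski_pos_of_slope[OF slope_sum_less_1[OF assms(1)]]) (auto simp: height_deriv_def)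
  have "smooth_submanifold 1 S"
    unfolding S using graph_smooth_submanifold[OF smooth_height] by simp
  moreover have "S = {y. snd y = eta f (\<Sum>i\<in>UNIV. xi f (fst y $ i))}"
    unfolding S by (simp add: height_def)
  moreover have "riemannian_metric S (induced_metric S)"
    using pos frame by (intro riemannian_induced_metric) (metis subspace_span)+
  moreover have "\<forall>y\<in>S. \<forall>v\<in>tangent_space S y. v \<noteq> 0 \<longrightarrow> induced_metric S y v v > 0"
    using pos by (simp add: induced_metric_def)
  ultimately show ?thesis
    using bij_eta frame by blast
qed

end
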